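(* Let $m$ be a positive integer and $\nu \pmod m$ a root of $X^3 \equiv 2 \pmod m$. Let $I$ be the ideal of $\mathbb{Z}[2^{1/3}]$ with $\mathbb{Z}$-basis $m,\ 2^{1/3} - \nu,\ 2^{2/3} - \nu^2$, and let $\alpha = a + b2^{1/3} + c2^{2/3}$ ($a,b,c \in \mathbb{Z}$) be a generator of $I$ lying in the fundamental domain $\mathcal{D}$ defined below. Let $u, v, w$ be integers satisfying $$u(a^2 - 2bc) + v(2c^2 - ab) + w(b^2 - ac) = 1.$$ Then each of the points $$\left(\frac{bu-cv}{b^2 - ac}, \frac{bv - au}{b^2 -ac}\right), \quad \left( \frac{cv - au}{2c^2 - ab}, \frac{2cu - bv}{2c^2 - ab}\right), \quad \left(\frac{au - bv}{a^2 - 2bc}, \frac{av - 2cu}{a^2 - 2bc}\right)$$ is within distance $\ll \frac{1}{m}$ of the point $\left(\frac{\nu}{m}, \frac{\nu^2}{m}\right)$ in $\mathbb{R}^2/\mathbb{Z}^2$, with an absolute implied constant.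
   Context: Let $K = \mathbb{Q}(2^{1/3})$, with ring of integers $\mathbb{Z}[2^{1/3}]$ (a principal ideal domain). For $\beta \in K$ let $\beta^{(1)}$ denote its image under the real embedding, $\beta^{(2)},\beta^{(3)}$ its images under the two complex embeddings, and $N(\beta)$ its norm. Let $\varepsilon = 1 + 2^{1/3} + 2^{2/3}$ be the fundamental unit. Define $$\mathcal{D}_1 = \left\{ \beta \in K : 2|N(\beta)|^{1/3} < \beta^{(1)} \le 2\varepsilon^{(1)} |N(\beta)|^{1/3} \right\}, \qquad \mathcal{D} = \{\beta \in K : \beta^{-1} \in \mathcal{D}_1\}.$$ $\mathcal{D}$ is a fundamental domain for the action of the unit group on $K^\times$ by multiplication.
   Formalization: The second and third points are false as printed (try a=n+1, b=n, c=-n and replace u,v by u+2c²-ab, v-a²+2bc); proved instead for ((cw-au)/(2c²-ab), (2cu-bw)/(2c²-ab)) and ((av-bw)/(a²-2bc), (aw-2cv)/(a²-2bc)). The first point is as printed. *)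

theory Defs
  imports
    "HOL-Analysis.Analysis"
    "HOL-Algebra.Algebraic_Closure_Type"
    "HOL-Algebra.Generated_Fields"
    "HOL-Number_Theory.Cong"
begin

definition cbrt2 :: real ("\<theta>") where
  "\<theta> = root 3 2"

abbreviation real_ring :: "real ring" where
  "real_ring \<equiv> ring_of_type_algebra"

abbreviation complex_ring :: "complex ring" where
  "complex_ring \<equiv> ring_of_type_algebra"

text \<open>
  The field \<open>\<rat>(\<theta>)\<close> is realised inside the reals, so its real embedding is the inclusion
  and \<open>\<beta>\<^sup>(\<^sup>1\<^sup>)\<close> is \<open>\<beta>\<close> itself.
\<close>

definition K :: "real ring" where
  "K = real_ring\<lparr>carrier := generate_field real_ring {\<theta>}\<rparr>"

definition OK :: "real ring" where
  "OK = real_ring\<lparr>carrier := generate_ring real_ring {\<theta>}\<rparr>"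

text \<open>
  The three embeddings of \<open>K\<close> into the complex numbers, the real one included. Extensionality
  makes each embedding a single HOL function.
\<close>

definition embeddings :: "(real \<Rightarrow> complex) set" where
  "embeddings = ring_hom K complex_ring \<inter> extensional (carrier K)"

definition norm_K :: "real \<Rightarrow> complex" where
  "norm_K \<beta> = (\<Prod>\<sigma>\<in>embeddings. \<sigma> \<beta>)"

definition fund_unit :: real ("\<epsilon>") where
  "\<epsilon> = 1 + \<theta> + \<theta>^2"

definition D1 :: "real set" where
  "D1 = {\<beta> \<in> carrier K. 2 * root 3 (cmod (norm_K \<beta>)) < \<beta> \<and>
                         \<beta> \<le> 2 * \<epsilon> * root 3 (cmod (norm_K \<beta>))}"

text \<open>The convention \<open>inverse 0 = 0\<close> does no harm, because \<open>0 \<notin> D1\<close>.\<close>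

definition D :: "real set" where
  "D = {\<beta> \<in> carrier K. inverse \<beta> \<in> D1}"

definition root_ideal :: "int \<Rightarrow> int \<Rightarrow> real set" where
  "root_ideal m \<nu> =
     {of_int x * of_int m + of_int y * (\<theta> - of_int \<nu>) + of_int z * (\<theta>^2 - of_int (\<nu>^2)) | x y z. True}"

text \<open>Distance in the quotient torus, between the classes of two points of the plane.\<close>

definition torus_dist :: "real \<times> real \<Rightarrow> real \<times> real \<Rightarrow> real" where
  "torus_dist p q = (INF z \<in> \<int> \<times> \<int>. dist p (q + z))"

text \<open>
  The carriers, the norm form \<open>N(x + y\<theta> + z\<theta>\<^sup>2) = x\<^sup>3 + 2y\<^sup>3 + 4z\<^sup>3 - 6xyz\<close>, and the fact that
  \<open>root_ideal m \<nu>\<close> is an ideal of which the three spanning elements form an integral basis.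
\<close>

lemma theta_cubed: "\<theta>^3 = 2"
  by (simp add: cbrt2_def odd_real_root_pow)

lemma theta_irrational: "\<theta> \<notin> \<rat>"
proof
  assume "\<theta> \<in> \<rat>"
  then obtain p q :: int where q: "q > 0" and pq: "coprime p q" and e: "\<theta> = of_int p / of_int q"
    by (rule Rats_cases') auto
  have "of_int (p^3) = (of_int (2 * q^3) :: real)"
    using theta_cubed q unfolding e by (simp add: field_simps)
  then have h: "p^3 = 2 * q^3" by (simp only: of_int_eq_iff)
  then have "even (p^3)" by simp
  then obtain k where k: "p = 2 * k" by (auto elim: evenE)
  with h have "q^3 = 2 * (2 * k^3)" by (simp add: power_mult_distrib)
  then have "even (q^3)" by simp
  then have "even q" by simp
  with k pq show False by (auto dest: coprime_common_divisor[of _ _ 2])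
qed

lemma theta_independent:
  fixes x y z :: real
  assumes rat: "x \<in> \<rat>" "y \<in> \<rat>" "z \<in> \<rat>" and eq: "x + y * \<theta> + z * \<theta>^2 = 0"
  shows "x = 0 \<and> y = 0 \<and> z = 0"
proof -
  have t3: "\<theta> * \<theta> * \<theta> = 2" using theta_cubed by (simp add: power3_eq_cube)
  have irr: "q = 0 \<and> p = 0" if "p \<in> \<rat>" "q \<in> \<rat>" "p + q * \<theta> = 0" for p q :: real
  proof -
    have "q = 0"
    proof (rule ccontr)
      assume "q \<noteq> 0"
      then have "\<theta> = - p / q" using that(3) by (simp add: field_simps)
      then show False using theta_irrational that by (metis Rats_divide Rats_minus_iff)
    qed
    then show ?thesis using that(3) by simp
  qed
  have "(x * y - 2 * z^2) + (y^2 - x * z) * \<theta> =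
      y * (x + y * \<theta> + z * \<theta>^2) - z * (\<theta> * (x + y * \<theta> + z * \<theta>^2)) + z^2 * (\<theta> * \<theta> * \<theta> - 2)"
    by (simp add: algebra_simps power2_eq_square)
  also have "\<dots> = 0" unfolding eq t3 by simp
  finally have "y^2 - x * z = 0 \<and> x * y - 2 * z^2 = 0"
    using rat by (intro irr) auto
  then have a: "y^2 = x * z" "x * y = 2 * z^2" by auto
  have "y^3 = x * y * z" using a(1) by (simp add: power3_eq_cube power2_eq_square)
  then have c: "y^3 = 2 * z^3" using a(2) by (simp add: power3_eq_cube power2_eq_square)
  have z: "z = 0"
  proof (rule ccontr)
    assume "z \<noteq> 0"
    then have "(y / z)^3 = 2" using c by (simp add: power_divide)
    then have "y / z = \<theta>" unfolding cbrt2_def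
      by (intro odd_real_root_unique[symmetric]) auto
    then show False using theta_irrational rat by (metis Rats_divide)
  qed
  then have "y = 0" using c by simp
  with z eq show ?thesis by simp
qed

lemma real_ring_inv: "x \<noteq> 0 \<Longrightarrow> inv\<^bsub>real_ring\<^esub> x = inverse x"
proof -
  interpret R: field real_ring by (rule field_from_type_algebra)
  assume "x \<noteq> 0"
  then show ?thesis
    by (intro R.inv_unique'[symmetric]) (auto simp: ring_of_type_algebra_def)
qed

lemma real_ring_minus: "\<ominus>\<^bsub>real_ring\<^esub> x = - x"
proof -
  interpret R: field real_ring by (rule field_from_type_algebra)
  show ?thesis
    by (intro R.minus_equality) (auto simp: ring_of_type_algebra_def)
qed

lemma mult_theta:
  "(a + b * \<theta> + c * \<theta>^2) * (a' + b' * \<theta> + c' * \<theta>^2) =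
   (a * a' + 2 * b * c' + 2 * c * b') + (a * b' + b * a' + 2 * c * c') * \<theta> + (a * c' + b * b' + c * a') * \<theta>^2"
proof -
  have t: "\<theta> * (\<theta> * \<theta>) = 2" using theta_cubed by (simp add: power3_eq_cube)
  have "(a + b * \<theta> + c * \<theta>^2) * (a' + b' * \<theta> + c' * \<theta>^2) =
     (a * a' + b * c' * (\<theta> * (\<theta> * \<theta>)) + c * b' * (\<theta> * (\<theta> * \<theta>))) +
     (a * b' + b * a' + c * c' * (\<theta> * (\<theta> * \<theta>))) * \<theta> + (a * c' + b * b' + c * a') * \<theta>^2"
    by (simp add: algebra_simps power2_eq_square)
  then show ?thesis unfolding t by simp
qed

lemma carrier_OK: "carrier OK = {of_int a + of_int b * \<theta> + of_int c * \<theta>^2 | a b c. True}"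
proof -
  interpret R: field real_ring by (rule field_from_type_algebra)
  note s = ring_of_type_algebra_def
  let ?E = "{of_int a + of_int b * \<theta> + of_int c * \<theta>^2 | a b c. True}"
  have I: "x \<in> ?E" if "x = of_int a + of_int b * \<theta> + of_int c * \<theta>^2" for x a b c
    using that by blast
  have sub: "subring ?E real_ring"
  proof (rule R.subringI)
    show "\<one>\<^bsub>real_ring\<^esub> \<in> ?E" by (rule I[of _ 1 0 0]) (simp add: s)
  next
    fix h assume "h \<in> ?E"
    then obtain a b c where "h = of_int a + of_int b * \<theta> + of_int c * \<theta>^2" by blast
    then show "\<ominus>\<^bsub>real_ring\<^esub> h \<in> ?E" by (intro I[of _ "-a" "-b" "-c"]) (simp add: real_ring_minus)
  next
    fix h h' assume "h \<in> ?E" "h' \<in> ?E"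
    then obtain a b c a' b' c' where *: "h = of_int a + of_int b * \<theta> + of_int c * \<theta>^2"
      "h' = of_int a' + of_int b' * \<theta> + of_int c' * \<theta>^2" by blast
    show "h \<otimes>\<^bsub>real_ring\<^esub> h' \<in> ?E"
      by (rule I[of _ "a * a' + 2 * b * c' + 2 * c * b'" "a * b' + b * a' + 2 * c * c'" "a * c' + b * b' + c * a'"])
         (simp add: s * mult_theta)
    show "h \<oplus>\<^bsub>real_ring\<^esub> h' \<in> ?E"
      by (rule I[of _ "a + a'" "b + b'" "c + c'"]) (simp add: s * algebra_simps)
  qed (simp add: s)
  have gen: "subring (generate_ring real_ring {\<theta>}) real_ring"
    by (rule R.generate_ring_is_subring) (simp add: s)
  have "?E = generate_ring real_ring {\<theta>}"
  proof (rule R.generate_ringI)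
    show "{\<theta>} \<subseteq> ?E" using I[of \<theta> 0 1 0] by simp
    fix L assume L: "subring L real_ring" "{\<theta>} \<subseteq> L"
    have add: "x + y \<in> L" if "x \<in> L" "y \<in> L" for x y
      using subringE(7)[OF L(1) that] by (simp add: s)
    have mul: "x * y \<in> L" if "x \<in> L" "y \<in> L" for x y
      using subringE(6)[OF L(1) that] by (simp add: s)
    have neg: "- x \<in> L" if "x \<in> L" for x
      using subringE(5)[OF L(1) that] by (simp add: real_ring_minus)
    have one: "1 \<in> L" and zero: "0 \<in> L"
      using subringE(2,3)[OF L(1)] by (simp_all add: s)
    have nat: "of_nat n \<in> L" for n by (induction n) (auto intro: add one zero)
    have int: "of_int n \<in> L" for n
      by (cases n rule: int_cases2) (auto intro: nat neg)
    show "?E \<subseteq> L" using L(2) by (auto intro!: add mul int simp: power2_eq_square)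
  qed (use sub in \<open>auto simp: s\<close>)
  then show ?thesis by (simp add: OK_def)
qed


lemma norm_form_eq:
  "(x + y * \<theta> + z * \<theta>^2) * ((x^2 - 2*y*z) + (2*z^2 - x*y) * \<theta> + (y^2 - x*z) * \<theta>^2) =
   x^3 + 2*y^3 + 4*z^3 - 6*x*y*z"
  unfolding mult_theta by (simp add: algebra_simps power2_eq_square power3_eq_cube)

lemma carrier_K: "carrier K = {x + y * \<theta> + z * \<theta>^2 | x y z. x \<in> \<rat> \<and> y \<in> \<rat> \<and> z \<in> \<rat>}"
proof -
  interpret R: field real_ring by (rule field_from_type_algebra)
  note s = ring_of_type_algebra_def
  let ?E = "{x + y * \<theta> + z * \<theta>^2 | x y z. x \<in> \<rat> \<and> y \<in> \<rat> \<and> z \<in> \<rat>}"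
  have I: "t \<in> ?E" if "t = x + y * \<theta> + z * \<theta>^2" "x \<in> \<rat>" "y \<in> \<rat>" "z \<in> \<rat>" for t x y z
    using that by blast
  have sub: "subring ?E real_ring"
  proof (rule R.subringI)
    show "\<one>\<^bsub>real_ring\<^esub> \<in> ?E" by (rule I[of _ 1 0 0]) (simp_all add: s)
  next
    fix h assume "h \<in> ?E"
    then obtain a b c where "h = a + b * \<theta> + c * \<theta>^2" "a \<in> \<rat>" "b \<in> \<rat>" "c \<in> \<rat>" by blast
    then show "\<ominus>\<^bsub>real_ring\<^esub> h \<in> ?E" by (intro I[of _ "-a" "-b" "-c"]) (simp_all add: real_ring_minus)
  next
    fix h h' assume "h \<in> ?E" "h' \<in> ?E"
    then obtain a b c a' b' c' where *: "h = a + b * \<theta> + c * \<theta>^2" "a \<in> \<rat>" "b \<in> \<rat>" "c \<in> \<rat>"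
      "h' = a' + b' * \<theta> + c' * \<theta>^2" "a' \<in> \<rat>" "b' \<in> \<rat>" "c' \<in> \<rat>" by blast
    show "h \<otimes>\<^bsub>real_ring\<^esub> h' \<in> ?E"
      by (rule I[of _ "a * a' + 2 * b * c' + 2 * c * b'" "a * b' + b * a' + 2 * c * c'" "a * c' + b * b' + c * a'"])
         (simp_all add: s * mult_theta)
    show "h \<oplus>\<^bsub>real_ring\<^esub> h' \<in> ?E"
      by (rule I[of _ "a + a'" "b + b'" "c + c'"]) (simp_all add: s * algebra_simps)
  qed (simp add: s)
  have sf: "subfield ?E real_ring"
  proof (rule R.subfieldI'[OF sub])
    fix k assume k: "k \<in> ?E - {\<zero>\<^bsub>real_ring\<^esub>}"
    then obtain x y z where *: "k = x + y * \<theta> + z * \<theta>^2" "x \<in> \<rat>" "y \<in> \<rat>" "z \<in> \<rat>" by blast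
    have k0: "k \<noteq> 0" using k by (simp add: s)
    define n where "n = x^3 + 2*y^3 + 4*z^3 - 6*x*y*z"
    define l where "l = (x^2 - 2*y*z) + (2*z^2 - x*y) * \<theta> + (y^2 - x*z) * \<theta>^2"
    have kl: "k * l = n" unfolding * l_def n_def by (rule norm_form_eq)
    have "l \<noteq> 0"
    proof
      assume "l = 0"
      then have 0: "x^2 - 2*y*z = 0" "2*z^2 - x*y = 0" "y^2 - x*z = 0"
        using theta_independent[of "x^2 - 2*y*z" "2*z^2 - x*y" "y^2 - x*z"] * by (auto simp: l_def)
      have "y^3 = 2 * z^3"
        using 0 by (simp add: power3_eq_cube power2_eq_square)
      then have "z + 0 * \<theta> + 0 * \<theta>^2 = 0"
        using theta_independent[of "0" y z] odd_real_root_unique[of 3 "y/z" 2]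
          theta_irrational Rats_divide[OF *(3,4)]
        by (cases "z = 0") (auto simp: cbrt2_def power_divide)
      then have "z = 0" by simp
      with 0 have "k = 0" unfolding * by simp
      with k0 show False by simp
    qed
    with kl k0 have n0: "n \<noteq> 0" by auto
    have inv: "inverse k = l / n" using kl k0 n0 by (simp add: field_simps)
    have nQ: "n \<in> \<rat>" using * by (simp add: n_def)
    show "inv\<^bsub>real_ring\<^esub> k \<in> ?E" unfolding real_ring_inv[OF k0] inv
      by (rule I[of _ "(x^2 - 2*y*z) / n" "(2*z^2 - x*y) / n" "(y^2 - x*z) / n"])
         (use * nQ in \<open>simp_all add: l_def add_divide_distrib\<close>)
  qed
  have "?E = generate_field real_ring {\<theta>}"
  proof (rule R.generate_fieldI)
    show "{\<theta>} \<subseteq> ?E" using I[of \<theta> 0 1 0] by simp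
    fix L assume L: "subfield L real_ring" "{\<theta>} \<subseteq> L"
    have Ls: "subring L real_ring" using subfieldE(1)[OF L(1)] .
    have add: "x + y \<in> L" if "x \<in> L" "y \<in> L" for x y
      using subringE(7)[OF Ls that] by (simp add: s)
    have mul: "x * y \<in> L" if "x \<in> L" "y \<in> L" for x y
      using subringE(6)[OF Ls that] by (simp add: s)
    have neg: "- x \<in> L" if "x \<in> L" for x
      using subringE(5)[OF Ls that] by (simp add: real_ring_minus)
    have one: "1 \<in> L" and zero: "0 \<in> L"
      using subringE(2,3)[OF Ls] by (simp_all add: s)
    have invL: "inverse x \<in> L" if "x \<in> L" for x
      using R.subfield_m_inv(1)[OF L(1), of x] that zero
      by (cases "x = 0") (auto simp: s real_ring_inv[unfolded s])
    have nat: "of_nat n \<in> L" for n by (induction n) (auto intro: add one zero)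
    have int: "of_int n \<in> L" for n
      by (cases n rule: int_cases2) (auto intro: nat neg)
    have rat: "x \<in> L" if "x \<in> \<rat>" for x
      using that by (cases rule: Rats_cases') (auto simp: divide_inverse intro!: mul int invL)
    show "?E \<subseteq> L" using L(2)
      by (auto simp: power2_eq_square) (intro add mul; (assumption | rule rat, assumption))
  qed (use sf in \<open>auto simp: s\<close>)
  then show ?thesis by (simp add: K_def)
qed

definition conj_map :: "complex \<Rightarrow> real \<Rightarrow> complex" where
  "conj_map \<omega> = (\<lambda>\<beta>\<in>carrier K. THE c. \<exists>x\<in>\<rat>. \<exists>y\<in>\<rat>. \<exists>z\<in>\<rat>. \<beta> = x + y * \<theta> + z * \<theta>^2 \<and>
      c = of_real x + of_real y * \<omega> + of_real z * \<omega>^2)"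

lemma conj_map:
  assumes "x \<in> \<rat>" "y \<in> \<rat>" "z \<in> \<rat>"
  shows "conj_map \<omega> (x + y * \<theta> + z * \<theta>^2) = of_real x + of_real y * \<omega> + of_real z * \<omega>^2"
proof -
  have uniq: "x' = x \<and> y' = y \<and> z' = z"
    if "x' \<in> \<rat>" "y' \<in> \<rat>" "z' \<in> \<rat>" "x + y * \<theta> + z * \<theta>^2 = x' + y' * \<theta> + z' * \<theta>^2" for x' y' z'
    using theta_independent[of "x' - x" "y' - y" "z' - z"] that assms by (simp add: algebra_simps)
  have "x + y * \<theta> + z * \<theta>^2 \<in> carrier K" using assms by (auto simp: carrier_K)
  then show ?thesis unfolding conj_map_def
    by (simp, intro the_equality) (use assms uniq in \<open>blast+\<close>)
qed

lemma embeddings_eq: "embeddings = conj_map ` {\<omega>. \<omega>^3 = 2}"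
proof (intro equalityI subsetI)
  note s = ring_of_type_algebra_def
  fix \<sigma> assume "\<sigma> \<in> embeddings"
  then have hom: "\<And>x y. x \<in> carrier K \<Longrightarrow> y \<in> carrier K \<Longrightarrow> \<sigma> (x * y) = \<sigma> x * \<sigma> y"
      "\<And>x y. x \<in> carrier K \<Longrightarrow> y \<in> carrier K \<Longrightarrow> \<sigma> (x + y) = \<sigma> x + \<sigma> y" "\<sigma> 1 = 1"
    and ext: "\<sigma> \<in> extensional (carrier K)"
    by (auto simp: embeddings_def ring_hom_def K_def s)
  have K: "x + y * \<theta> + z * \<theta>^2 \<in> carrier K" if "x \<in> \<rat>" "y \<in> \<rat>" "z \<in> \<rat>" for x y z
    using that by (auto simp: carrier_K)
  have Q: "x \<in> carrier K" if "x \<in> \<rat>" for x using K[of x 0 0] that by simp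
  have th: "\<theta> \<in> carrier K" using K[of 0 1 0] by simp
  have th2: "\<theta>^2 \<in> carrier K" using K[of 0 0 1] by simp
  have \<sigma>0: "\<sigma> 0 = 0" using hom(2)[of 0 0] Q by simp
  have nat: "\<sigma> (of_nat n) = of_nat n" for n
    by (induction n) (simp_all add: \<sigma>0 hom Q)
  have neg: "\<sigma> (- x) = - \<sigma> x" if "x \<in> \<rat>" for x
    using hom(2)[of x "-x"] that Q \<sigma>0 by (simp add: eq_neg_iff_add_eq_0 add.commute)
  have int: "\<sigma> (of_int n) = of_int n" for n
    by (cases n rule: int_cases2) (simp_all add: nat neg)
  have rat: "\<sigma> x = of_real x" if "x \<in> \<rat>" for x
  proof -
    from that obtain p q :: int where q: "q > 0" "x = of_int p / of_int q"
      by (rule Rats_cases') auto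
    have "\<sigma> (x * of_int q) = \<sigma> x * \<sigma> (of_int q)" using that by (intro hom Q) auto
    moreover have "x * of_int q = of_int p" using q by simp
    ultimately have "of_int p = \<sigma> x * of_int q" by (simp add: int)
    moreover have "(of_int p :: complex) = of_real x * of_int q" using q by simp
    ultimately show ?thesis using q(1) by simp
  qed
  have "\<sigma> (\<theta> * \<theta>^2) = \<sigma> \<theta> * \<sigma> (\<theta>^2)" by (intro hom th th2)
  moreover have sq: "\<sigma> (\<theta>^2) = \<sigma> \<theta> ^ 2" using hom(1)[OF th th] by (simp add: power2_eq_square)
  moreover have "\<theta> * \<theta>^2 = of_int 2" using theta_cubed by (simp add: power2_eq_square power3_eq_cube)
  ultimately have root: "\<sigma> \<theta> ^ 3 = 2" using int[of 2] by (simp add: power2_eq_square power3_eq_cube mult.assoc)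
  have "\<sigma> = conj_map (\<sigma> \<theta>)"
  proof (rule extensionalityI[OF ext])
    show "conj_map (\<sigma> \<theta>) \<in> extensional (carrier K)" by (simp add: conj_map_def)
    fix \<beta> assume "\<beta> \<in> carrier K"
    then obtain x y z where *: "\<beta> = x + y * \<theta> + z * \<theta>^2" "x \<in> \<rat>" "y \<in> \<rat>" "z \<in> \<rat>"
      by (auto simp: carrier_K)
    have m: "y * \<theta> \<in> carrier K" "z * \<theta>^2 \<in> carrier K" "x + y * \<theta> \<in> carrier K"
      using K[of 0 y 0] K[of 0 0 z] K[of x y 0] * by simp_all
    show "\<sigma> \<beta> = conj_map (\<sigma> \<theta>) \<beta>" unfolding *(1) using *(2-)
      by (simp add: conj_map hom m Q th th2 rat sq)
  qed
  then show "\<sigma> \<in> conj_map ` {\<omega>. \<omega>^3 = 2}" using root by blast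
next
  note s = ring_of_type_algebra_def
  fix \<sigma> assume "\<sigma> \<in> conj_map ` {\<omega>. \<omega>^3 = 2}"
  then obtain \<omega> where \<omega>: "\<omega>^3 = 2" "\<sigma> = conj_map \<omega>" by auto
  have t: "\<omega> * (\<omega> * \<omega>) = 2" using \<omega> by (simp add: power3_eq_cube mult.assoc)
  have mult: "(a + b * \<omega> + c * \<omega>^2) * (a' + b' * \<omega> + c' * \<omega>^2) =
     (a * a' + 2 * b * c' + 2 * c * b') + (a * b' + b * a' + 2 * c * c') * \<omega> + (a * c' + b * b' + c * a') * \<omega>^2"
    for a b c a' b' c'
  proof -
    have "(a + b * \<omega> + c * \<omega>^2) * (a' + b' * \<omega> + c' * \<omega>^2) =
     (a * a' + b * c' * (\<omega> * (\<omega> * \<omega>)) + c * b' * (\<omega> * (\<omega> * \<omega>))) +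
     (a * b' + b * a' + c * c' * (\<omega> * (\<omega> * \<omega>))) * \<omega> + (a * c' + b * b' + c * a') * \<omega>^2"
      by (simp add: algebra_simps power2_eq_square)
    then show ?thesis unfolding t by simp
  qed
  have "\<sigma> (x * y) = \<sigma> x * \<sigma> y \<and> \<sigma> (x + y) = \<sigma> x + \<sigma> y"
    if xy: "x \<in> carrier K" "y \<in> carrier K" for x y
  proof -
    from xy obtain a b c a' b' c' where *: "x = a + b * \<theta> + c * \<theta>^2" "a \<in> \<rat>" "b \<in> \<rat>" "c \<in> \<rat>"
      "y = a' + b' * \<theta> + c' * \<theta>^2" "a' \<in> \<rat>" "b' \<in> \<rat>" "c' \<in> \<rat>" by (auto simp: carrier_K)
    have p: "x + y = (a + a') + (b + b') * \<theta> + (c + c') * \<theta>^2" by (simp add: * algebra_simps)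
    have "\<sigma> (x * y) = \<sigma> x * \<sigma> y"
      unfolding *(1,5) \<omega>(2) mult_theta using *(2-4,6-8)
      by (subst (1 2 3) conj_map) (simp_all add: mult)
    moreover have "\<sigma> (x + y) = \<sigma> x + \<sigma> y"
      unfolding p unfolding *(1,5) \<omega>(2) using *(2-4,6-8)
      by (subst (1 2 3) conj_map) (simp_all add: algebra_simps)
    ultimately show ?thesis by simp
  qed
  moreover have "\<sigma> 1 = 1" using conj_map[of 1 0 0 \<omega>] by (simp add: \<omega>)
  moreover have "\<sigma> \<in> extensional (carrier K)" by (simp add: \<omega> conj_map_def)
  ultimately show "\<sigma> \<in> embeddings" by (auto simp: embeddings_def ring_hom_def K_def s)
qed

lemma norm_K_eq:
  assumes "x \<in> \<rat>" "y \<in> \<rat>" "z \<in> \<rat>"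
  shows "norm_K (x + y * \<theta> + z * \<theta>^2) = of_real (x^3 + 2*y^3 + 4*z^3 - 6*x*y*z)"
proof -
  define \<zeta> where "\<zeta> = Complex (-1/2) (sqrt 3 / 2)"
  define t where "t = complex_of_real \<theta>"
  have \<zeta>2: "\<zeta>^2 = - 1 - \<zeta>" by (simp add: \<zeta>_def complex_eq_iff power2_eq_square)
  have \<zeta>3: "\<zeta>^3 = 1" by (simp add: \<zeta>_def complex_eq_iff power3_eq_cube)
  have \<zeta>6: "\<zeta>^6 = 1" using power_mult[of \<zeta> 3 2] \<zeta>3 by simp
  have t3: "t^3 = 2" using theta_cubed unfolding t_def by (metis of_real_numeral of_real_power)
  then have t0: "t \<noteq> 0" by auto
  have roots: "{\<omega>. \<omega>^3 = 2} = {t, t * \<zeta>, t * \<zeta>^2}"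
  proof (intro equalityI subsetI)
    fix \<omega> assume "\<omega> \<in> {\<omega>. \<omega>^3 = (2::complex)}"
    then have "\<omega>^3 - t^3 = 0" using t3 by simp
    moreover have "(\<omega> - t) * (\<omega> - t * \<zeta>) * (\<omega> - t * \<zeta>^2) = \<omega>^3 - t^3"
    proof -
      have "(\<omega> - t) * (\<omega> - t * \<zeta>) * (\<omega> - t * \<zeta>^2) = \<omega>^3 - t * \<omega>^2 * (1 + \<zeta> + \<zeta>^2)
          + t^2 * \<omega> * (\<zeta> + \<zeta>^2 + \<zeta>^3) - t^3 * \<zeta>^3"
        by (simp add: algebra_simps power2_eq_square power3_eq_cube)
      then show ?thesis by (simp add: \<zeta>2 \<zeta>3)
    qed
    ultimately have "(\<omega> - t) * (\<omega> - t * \<zeta>) * (\<omega> - t * \<zeta>^2) = 0" by metis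
    then show "\<omega> \<in> {t, t * \<zeta>, t * \<zeta>^2}" by auto
  next
    fix \<omega> assume "\<omega> \<in> {t, t * \<zeta>, t * \<zeta>^2}"
    then show "\<omega> \<in> {\<omega>. \<omega>^3 = 2}" using t3 \<zeta>3
      by (auto simp: power_mult_distrib \<zeta>6 simp flip: power_mult)
  qed
  have d: "\<zeta> \<noteq> 1" "\<zeta>^2 \<noteq> 1" "\<zeta> \<noteq> \<zeta>^2" unfolding \<zeta>2 by (auto simp: \<zeta>_def complex_eq_iff)
  have inj: "inj_on conj_map A" for A
  proof (rule inj_onI)
    fix \<omega> \<omega>' assume "conj_map \<omega> = conj_map \<omega>'"
    then show "\<omega> = \<omega>'" using conj_map[of 0 1 0 \<omega>] conj_map[of 0 1 0 \<omega>'] by simp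
  qed
  define x1 where "x1 = complex_of_real x"
  define y1 where "y1 = complex_of_real y"
  define z1 where "z1 = complex_of_real z"
  note XYZ = x1_def y1_def z1_def
  have "norm_K (x + y * \<theta> + z * \<theta>^2) = (\<Prod>\<omega>\<in>{t, t * \<zeta>, t * \<zeta>^2}. x1 + y1 * \<omega> + z1 * \<omega>^2)"
    unfolding norm_K_def embeddings_eq roots by (subst prod.reindex[OF inj]) (simp add: conj_map assms XYZ)
  also have "\<dots> = (x1 + y1 * t + z1 * t^2) * ((x1 + y1 * (t * \<zeta>) + z1 * (t * \<zeta>)^2) * (x1 + y1 * (t * \<zeta>^2) + z1 * (t * \<zeta>^2)^2))"
    using d t0 by (subst prod.insert; simp)+
  also have "\<dots> = x1^3 + 2*y1^3 + 4*z1^3 - 6*x1*y1*z1"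
  proof -
    define y2 where "y2 = y1 * t"
    define z2 where "z2 = z1 * t^2"
    have "(x1 + y1 * (t * \<zeta>) + z1 * (t * \<zeta>)^2) * (x1 + y1 * (t * \<zeta>^2) + z1 * (t * \<zeta>^2)^2) =
        (x1 + y2 * \<zeta> + z2 * \<zeta>^2) * (x1 + y2 * \<zeta>^2 + z2 * (\<zeta> * \<zeta>^3))"
      by (simp add: y2_def z2_def power_mult_distrib eval_nat_numeral algebra_simps)
    also have "\<dots> = (x1 - z2 + (y2 - z2) * \<zeta>) * (x1 - y2 - (y2 - z2) * \<zeta>)"
      unfolding \<zeta>3 unfolding \<zeta>2 by (simp add: algebra_simps)
    also have "\<dots> = (x1 - z2) * (x1 - y2) - (y2 - z2)^2 * (\<zeta> + \<zeta>^2)"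
      by (simp add: algebra_simps power2_eq_square)
    also have "\<dots> = (x1 - z2) * (x1 - y2) + (y2 - z2)^2"
      unfolding \<zeta>2 by simp
    finally have "(x1 + y1 * t + z1 * t^2) * ((x1 + y1 * (t * \<zeta>) + z1 * (t * \<zeta>)^2) * (x1 + y1 * (t * \<zeta>^2) + z1 * (t * \<zeta>^2)^2))
        = (x1 + y2 + z2) * ((x1 - z2) * (x1 - y2) + (y2 - z2)^2)"
      by (simp add: y2_def z2_def)
    also have "\<dots> = x1^3 + y2^3 + z2^3 - 3 * x1 * y2 * z2"
      by (simp add: algebra_simps power2_eq_square power3_eq_cube)
    also have "y2^3 = 2 * y1^3" by (simp add: y2_def power_mult_distrib t3)
    also have "z2^3 = z1^3 * (t^3)^2" by (simp add: z2_def power_mult_distrib flip: power_mult)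
    also have "3 * x1 * y2 * z2 = 3 * x1 * y1 * z1 * t^3" by (simp add: y2_def z2_def eval_nat_numeral)
    finally show ?thesis by (simp add: t3)
  qed
  finally show ?thesis by (simp add: XYZ)
qed

lemma root_ideal_ideal:
  assumes "[\<nu>^3 = 2] (mod m)"
  shows "ideal (root_ideal m \<nu>) OK"
proof -
  interpret R: field real_ring by (rule field_from_type_algebra)
  note s = ring_of_type_algebra_def
  have ring: "ring OK" unfolding OK_def
    by (rule R.generate_ring_is_ring) (simp add: s)
  interpret O: ring OK by (rule ring)
  have ops: "x \<otimes>\<^bsub>OK\<^esub> y = x * y" "x \<oplus>\<^bsub>OK\<^esub> y = x + y" "\<zero>\<^bsub>OK\<^esub> = 0" "\<one>\<^bsub>OK\<^esub> = 1" for x y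
    by (simp_all add: OK_def s)
  have eq: "root_ideal m \<nu> = {of_int a + of_int b * \<theta> + of_int c * \<theta>^2 | a b c. m dvd a + b * \<nu> + c * \<nu>^2}"
    (is "_ = ?I")
  proof (intro equalityI subsetI)
    fix t assume "t \<in> root_ideal m \<nu>"
    then obtain x y z where t: "t = of_int x * of_int m + of_int y * (\<theta> - of_int \<nu>) + of_int z * (\<theta>^2 - of_int (\<nu>^2))"
      by (auto simp: root_ideal_def)
    have "t = of_int (x * m - y * \<nu> - z * \<nu>^2) + of_int y * \<theta> + of_int z * \<theta>^2"
      by (simp add: t algebra_simps)
    moreover have "m dvd (x * m - y * \<nu> - z * \<nu>^2) + y * \<nu> + z * \<nu>^2" by simp
    ultimately show "t \<in> ?I" by blast
  next
    fix t assume "t \<in> ?I"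
    then obtain a b c x where t: "t = of_int a + of_int b * \<theta> + of_int c * \<theta>^2" and x: "a + b * \<nu> + c * \<nu>^2 = m * x"
      by (auto simp: dvd_def)
    have a: "a = m * x - b * \<nu> - c * \<nu>^2" using x by simp
    have "t = of_int x * of_int m + of_int b * (\<theta> - of_int \<nu>) + of_int c * (\<theta>^2 - of_int (\<nu>^2))"
      by (simp add: t a algebra_simps)
    then show "t \<in> root_ideal m \<nu>" unfolding root_ideal_def by blast
  qed
  have I: "t \<in> ?I" if "t = of_int a + of_int b * \<theta> + of_int c * \<theta>^2" "m dvd a + b * \<nu> + c * \<nu>^2" for t a b c
    using that by blast
  have mult: "x * a \<in> ?I" if "a \<in> ?I" "x \<in> carrier OK" for a x
  proof -
    from that obtain a1 b1 c1 a2 b2 c2 where *: "a = of_int a1 + of_int b1 * \<theta> + of_int c1 * \<theta>^2"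
      "x = of_int a2 + of_int b2 * \<theta> + of_int c2 * \<theta>^2" and d: "m dvd a1 + b1 * \<nu> + c1 * \<nu>^2"
      unfolding carrier_OK by blast
    let ?A = "a2 * a1 + 2 * b2 * c1 + 2 * c2 * b1" and ?B = "a2 * b1 + b2 * a1 + 2 * c2 * c1"
      and ?C = "a2 * c1 + b2 * b1 + c2 * a1"
    have "m dvd \<nu>^3 - 2" using assms by (simp add: cong_iff_dvd_diff)
    then have "m dvd (a2 + b2 * \<nu> + c2 * \<nu>^2) * (a1 + b1 * \<nu> + c1 * \<nu>^2) - (\<nu>^3 - 2) * (b2 * c1 + c2 * b1 + c2 * c1 * \<nu>)"
      using d by (rule_tac dvd_diff[OF dvd_mult dvd_mult2])
    also have "\<dots> = ?A + ?B * \<nu> + ?C * \<nu>^2"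
      by (simp add: algebra_simps power2_eq_square power3_eq_cube)
    finally show ?thesis
      by (intro I[of _ ?A ?B ?C]) (simp_all add: * mult_theta)
  qed
  show ?thesis unfolding eq
  proof (rule idealI[OF ring])
    show "subgroup ?I (add_monoid OK)"
    proof (rule O.add.subgroupI)
      show "?I \<subseteq> carrier OK" by (auto simp: carrier_OK)
      show "?I \<noteq> {}" using I[of 0 0 0 0] by auto
    next
      fix a assume a: "a \<in> ?I"
      then have "a \<in> carrier OK" by (auto simp: carrier_OK)
      have m1: "-1 \<in> carrier OK" unfolding carrier_OK by (simp, intro exI[of _ "-1"] exI[of _ 0]) simp
      have "-a \<in> ?I" using mult[OF a m1] by simp
      then have "-a \<in> carrier OK" by (auto simp: carrier_OK)
      then have "\<ominus>\<^bsub>OK\<^esub> a = -a"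
        using \<open>a \<in> carrier OK\<close> by (intro O.minus_equality) (simp_all add: ops)
      then show "\<ominus>\<^bsub>OK\<^esub> a \<in> ?I" using \<open>-a \<in> ?I\<close> by simp
    next
      fix a b assume "a \<in> ?I" "b \<in> ?I"
      then obtain a1 b1 c1 a2 b2 c2 where *: "a = of_int a1 + of_int b1 * \<theta> + of_int c1 * \<theta>^2"
        "b = of_int a2 + of_int b2 * \<theta> + of_int c2 * \<theta>^2" and d: "m dvd a1 + b1 * \<nu> + c1 * \<nu>^2" "m dvd a2 + b2 * \<nu> + c2 * \<nu>^2"
        by blast
      have "m dvd (a1 + a2) + (b1 + b2) * \<nu> + (c1 + c2) * \<nu>^2"
        using dvd_add[OF d] by (simp add: algebra_simps)
      then show "a \<oplus>\<^bsub>OK\<^esub> b \<in> ?I"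
        by (intro I[of _ "a1 + a2" "b1 + b2" "c1 + c2"]) (simp_all add: ops * algebra_simps)
    qed
  qed (use mult in \<open>simp_all only: ops mult.commute\<close>)
qed

lemma root_ideal_basis:
  fixes x y z :: int
  assumes "m \<noteq> 0" "of_int x * of_int m + of_int y * (\<theta> - of_int \<nu>) + of_int z * (\<theta>^2 - of_int (\<nu>^2)) = 0"
  shows "x = 0 \<and> y = 0 \<and> z = 0"
proof -
  have "(of_int (x * m - y * \<nu> - z * \<nu>^2)) + of_int y * \<theta> + of_int z * \<theta>^2 = 0"
    using assms(2) by (simp add: algebra_simps)
  from theta_independent[OF _ _ _ this] assms(1) show ?thesis by auto
qed

end

theory Submission
  imports Defs
begin

text \<open>
  Write \<open>A + B\<theta> + C\<theta>\<^sup>2 = N(\<alpha>)/\<alpha>\<close> with \<open>A = a\<^sup>2 - 2bc\<close>, \<open>B = 2c\<^sup>2 - ab\<close>, \<open>C = b\<^sup>2 - ac\<close>. As \<open>uA + vB + wC = 1\<close>,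
  the norm of \<open>\<alpha>\<close> is \<open>m\<close>. The integers \<open>\<nu>' = 2Cu + Av + Bw\<close> and \<open>\<nu>'' = 2Bu + 2Cv + Aw\<close> are
  congruent to \<open>\<nu>\<close> and \<open>\<nu>\<^sup>2\<close> modulo \<open>m\<close>, and Cramer's rule shows that the three points differ from
  \<open>(\<nu>'/m, \<nu>''/m)\<close> by \<open>-(B, A)/(Cm)\<close>, \<open>-(A, 2C)/(Bm)\<close> and \<open>-(2C, 2B)/(Am)\<close>. That \<open>\<alpha>\<close> lies in \<open>D\<close> means
  that the complex conjugates of \<open>m/\<alpha>\<close> are small compared with \<open>m/\<alpha>\<close>, so that \<open>A\<close>, \<open>B\<theta>\<close>, \<open>C\<theta>\<^sup>2\<close> are
  all comparable to \<open>m/\<alpha>\<close>.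
\<close>

lemma theta_ge_1: "1 \<le> \<theta>" and theta_le_2: "\<theta> \<le> 2"
proof -
  show "1 \<le> \<theta>" by (simp add: cbrt2_def)
  have "root 3 2 \<le> root 3 (2^3 :: real)" by (subst real_root_le_iff) auto
  then show "\<theta> \<le> 2" by (simp add: cbrt2_def real_root_power_cancel)
qed

section \<open>The ideal modulo m and the norm of its generator\<close>

lemma OK_mult: "x \<otimes>\<^bsub>OK\<^esub> y = x * y"
  by (simp add: OK_def ring_of_type_algebra_def)

text \<open>Substituting \<nu> for \<theta> sends the basis elements to m, 0 and 0. Independence of
  1, \<theta>, \<theta>^2 makes this substitution well defined on coordinates.\<close>

lemma in_root_ideal_dvd:
  assumes "of_int a + of_int b * \<theta> + of_int c * \<theta>^2 \<in> root_ideal m \<nu>"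
  shows "m dvd a + b * \<nu> + c * \<nu>^2"
proof -
  obtain x y z where
    "of_int a + of_int b * \<theta> + of_int c * \<theta>^2 =
      of_int x * of_int m + of_int y * (\<theta> - of_int \<nu>) + of_int z * (\<theta>^2 - of_int (\<nu>^2))"
    using assms unfolding root_ideal_def by blast
  then have "of_int (a - x * m + y * \<nu> + z * \<nu>^2) + of_int (b - y) * \<theta> + of_int (c - z) * \<theta>^2 = 0"
    by (simp add: algebra_simps)
  from theta_independent[OF _ _ _ this]
  have "a - x * m + y * \<nu> + z * \<nu>^2 = 0" "b = y" "c = z"
    by (simp_all only: of_int_eq_0_iff Rats_of_int) simp_all
  then have "a + b * \<nu> + c * \<nu>^2 = m * x" by (simp add: algebra_simps)
  then show ?thesis by simp
qed

lemma of_int_in_root_ideal: "of_int m \<in> root_ideal m \<nu>"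
  unfolding root_ideal_def by (intro CollectI exI[of _ 1] exI[of _ 0]) simp

text \<open>The three divisors come from \<alpha>, \<theta>\<alpha> and \<theta>^2\<alpha>, all in
  the ideal, by reducing with \<theta>^3 = 2 and then replacing \<theta> by \<nu>.\<close>

lemma generator_dvd:
  assumes "PIdl\<^bsub>OK\<^esub> (of_int a + of_int b * \<theta> + of_int c * \<theta>^2) = root_ideal m \<nu>"
  shows "m dvd a + b * \<nu> + c * \<nu>^2" "m dvd 2 * c + a * \<nu> + b * \<nu>^2"
    "m dvd 2 * b + 2 * c * \<nu> + a * \<nu>^2"
proof -
  have *: "(of_int x + of_int y * \<theta> + of_int z * \<theta>^2) * (of_int a + of_int b * \<theta> + of_int c * \<theta>^2)
      \<in> root_ideal m \<nu>" for x y z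
    unfolding assms[symmetric] cgenideal_def OK_mult carrier_OK by blast
  show "m dvd a + b * \<nu> + c * \<nu>^2"
    using *[of 1 0 0] by (intro in_root_ideal_dvd) simp
  show "m dvd 2 * c + a * \<nu> + b * \<nu>^2"
    using *[of 0 1 0, unfolded mult_theta] by (intro in_root_ideal_dvd) simp
  show "m dvd 2 * b + 2 * c * \<nu> + a * \<nu>^2"
    using *[of 0 0 1, unfolded mult_theta] by (intro in_root_ideal_dvd) simp
qed

text \<open>This is the product of the two complex conjugates of x + y\<theta> + z\<theta>^2, hence
  a squared modulus; here it appears as half a sum of three squares.\<close>

lemma adjugate_nonneg:
  fixes x y z :: real
  shows "0 \<le> (x^2 - 2*y*z) + (2*z^2 - x*y) * \<theta> + (y^2 - x*z) * \<theta>^2"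
proof -
  have t3: "\<theta> * (\<theta> * \<theta>) = 2" using theta_cubed by (simp add: power3_eq_cube)
  have "(x - y*\<theta>)^2 + (y*\<theta> - z*\<theta>^2)^2 + (z*\<theta>^2 - x)^2 =
      2 * (x^2 + y^2 * \<theta>^2 + z^2 * \<theta> * (\<theta> * (\<theta> * \<theta>)) - x*y*\<theta> - y*z*(\<theta> * (\<theta> * \<theta>)) - x*z*\<theta>^2)"
    by (simp add: algebra_simps power2_eq_square)
  also have "\<dots> = 2 * ((x^2 - 2*y*z) + (2*z^2 - x*y) * \<theta> + (y^2 - x*z) * \<theta>^2)"
    unfolding t3 by (simp add: algebra_simps)
  finally show ?thesis
    by (metis add_nonneg_nonneg zero_le_power2 zero_le_mult_iff zero_less_numeral less_le_not_le)
qed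

text \<open>The norm n and m divide each other. For n dvd m: since m is a multiple \<xi>\<alpha>
  with \<xi> in \<open>OK\<close>, m\<alpha>' = n\<xi>, so n divides mA, mB and mC, hence also m(uA
  + vB + wC) = m. The sign of n follows from \<alpha> > 0 and \<alpha>' >= 0.\<close>

lemma generator_norm:
  fixes m \<nu> a b c u v w :: int
  defines "\<alpha> \<equiv> of_int a + of_int b * \<theta> + of_int c * \<theta>^2 :: real"
  assumes m: "m > 0"
    and gen: "PIdl\<^bsub>OK\<^esub> \<alpha> = root_ideal m \<nu>"
    and pos: "\<alpha> > 0"
    and uvw: "u * (a^2 - 2*b*c) + v * (2*c^2 - a*b) + w * (b^2 - a*c) = 1"
  shows "a^3 + 2*b^3 + 4*c^3 - 6*a*b*c = m"
proof -
  define n where "n = a^3 + 2*b^3 + 4*c^3 - 6*a*b*c"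
  define A where "A = a^2 - 2*b*c"
  define B where "B = 2*c^2 - a*b"
  define C where "C = b^2 - a*c"
  define \<alpha>' where "\<alpha>' = of_int A + of_int B * \<theta> + of_int C * \<theta>^2"
  have \<alpha>\<alpha>': "\<alpha> * \<alpha>' = of_int n"
    using norm_form_eq[of "of_int a" "of_int b" "of_int c"]
    by (simp add: \<alpha>_def \<alpha>'_def A_def B_def C_def n_def)
  have "\<alpha>' \<ge> 0"
    using adjugate_nonneg[of "of_int a" "of_int b" "of_int c"]
    by (simp add: \<alpha>'_def A_def B_def C_def)
  then have "(of_int n :: real) \<ge> 0" unfolding \<alpha>\<alpha>'[symmetric] using pos by simp
  then have n0: "n \<ge> 0" by simp
  \<comment> \<open>The product \<alpha>'\<alpha> = n with \<nu> in place of \<theta>: the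
    coefficients of \<nu> and \<nu>^2 cancel.\<close>
  have "n = A * (a + b * \<nu> + c * \<nu>^2) + B * (2 * c + a * \<nu> + b * \<nu>^2)
      + C * (2 * b + 2 * c * \<nu> + a * \<nu>^2)"
    by (simp add: n_def A_def B_def C_def algebra_simps power2_eq_square power3_eq_cube)
  moreover have "m dvd \<dots>"
    by (intro dvd_add dvd_mult generator_dvd[OF gen[unfolded \<alpha>_def]])
  ultimately have "m dvd n" by simp
  moreover have "n dvd m"
  proof -
    have "of_int m \<in> PIdl\<^bsub>OK\<^esub> \<alpha>" unfolding gen by (rule of_int_in_root_ideal)
    then obtain x y z where
      "of_int m = (of_int x + of_int y * \<theta> + of_int z * \<theta>^2) * \<alpha>"
      unfolding cgenideal_def OK_mult carrier_OK by blast
    then have "of_int m * \<alpha>' = (of_int x + of_int y * \<theta> + of_int z * \<theta>^2) * (\<alpha> * \<alpha>')"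
      by simp
    then have "of_int (m * A - n * x) + of_int (m * B - n * y) * \<theta> + of_int (m * C - n * z) * \<theta>^2 = 0"
      unfolding \<alpha>\<alpha>' by (simp add: \<alpha>'_def algebra_simps)
    from theta_independent[OF _ _ _ this]
    have *: "m * A = n * x" "m * B = n * y" "m * C = n * z"
      by (simp_all flip: of_int_mult)
    have "m = m * (u * A + v * B + w * C)" using uvw by (simp add: A_def B_def C_def)
    also have "\<dots> = u * (m * A) + v * (m * B) + w * (m * C)" by (simp add: algebra_simps)
    also have "\<dots> = n * (u * x + v * y + w * z)" unfolding * by (simp add: algebra_simps)
    finally show ?thesis by simp
  qed
  ultimately show ?thesis using m n0 unfolding n_def[symmetric] by (simp add: zdvd_antisym_nonneg)
qed

section \<open>Size of the coordinates of the adjugate for elements of \<open>D\<close>\<close>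

lemma D_imp_inverse_pos:
  assumes "\<beta> \<in> D"
  shows "inverse \<beta> > 0"
proof -
  have "0 \<le> 2 * root 3 (cmod (norm_K (inverse \<beta>)))" by simp
  also have "\<dots> < inverse \<beta>" using assms unfolding D_def D1_def by blast
  finally show ?thesis .
qed

text \<open>The inverse of the element is S/n and has norm 1/n, so the lower inequality of
  \<open>D1\<close> reads 2(1/n)^(1/3) < S/n; cubing gives the bound.\<close>

lemma D_adjugate_bound:
  fixes x y z n :: real
  defines "S \<equiv> (x^2 - 2*y*z) + (2*z^2 - x*y) * \<theta> + (y^2 - x*z) * \<theta>^2"
  assumes rat: "x \<in> \<rat>" "y \<in> \<rat>" "z \<in> \<rat>"
    and n: "x^3 + 2*y^3 + 4*z^3 - 6*x*y*z = n" "n > 0"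
    and D: "x + y * \<theta> + z * \<theta>^2 \<in> D"
  shows "8 * n^2 < S^3"
proof -
  define \<alpha> where "\<alpha> = x + y * \<theta> + z * \<theta>^2"
  have \<alpha>S: "\<alpha> * S = n" unfolding \<alpha>_def S_def norm_form_eq n(1) ..
  have inv: "inverse \<alpha> = S / n" using \<alpha>S n(2) by (auto simp: field_simps)
  have "norm_K ((x^2 - 2*y*z) / n + (2*z^2 - x*y) / n * \<theta> + (y^2 - x*z) / n * \<theta>^2) =
      of_real (((x^2 - 2*y*z) / n)^3 + 2*((2*z^2 - x*y) / n)^3 + 4*((y^2 - x*z) / n)^3
        - 6*((x^2 - 2*y*z) / n)*((2*z^2 - x*y) / n)*((y^2 - x*z) / n))"
    using rat n(1) by (intro norm_K_eq) auto
  also have "(x^2 - 2*y*z) / n + (2*z^2 - x*y) / n * \<theta> + (y^2 - x*z) / n * \<theta>^2 = inverse \<alpha>"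
    unfolding inv S_def by (simp add: add_divide_distrib)
  also have "((x^2 - 2*y*z) / n)^3 + 2*((2*z^2 - x*y) / n)^3 + 4*((y^2 - x*z) / n)^3
        - 6*((x^2 - 2*y*z) / n)*((2*z^2 - x*y) / n)*((y^2 - x*z) / n) =
      ((x^2 - 2*y*z)^3 + 2*(2*z^2 - x*y)^3 + 4*(y^2 - x*z)^3
        - 6*(x^2 - 2*y*z)*(2*z^2 - x*y)*(y^2 - x*z)) / n^3"
    using n(2) by (simp add: field_simps power3_eq_cube)
  \<comment> \<open>The adjugate n/\<alpha> has norm n^3/n = n^2.\<close>
  also have "(x^2 - 2*y*z)^3 + 2*(2*z^2 - x*y)^3 + 4*(y^2 - x*z)^3
        - 6*(x^2 - 2*y*z)*(2*z^2 - x*y)*(y^2 - x*z) = n^2"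
    unfolding n(1)[symmetric] by (simp add: algebra_simps power2_eq_square power3_eq_cube)
  also have "n^2 / n^3 = 1 / n" using n(2) by (simp add: power2_eq_square power3_eq_cube)
  finally have "cmod (norm_K (inverse \<alpha>)) = 1 / n" using n(2) by (simp add: norm_divide)
  then have lt: "2 * root 3 (1 / n) < S / n"
    using D unfolding D_def D1_def \<alpha>_def[symmetric] inv[symmetric] by simp
  have "(2 * root 3 (1 / n))^3 < (S / n)^3"
    using lt n(2) by (intro power_strict_mono) auto
  moreover have "root 3 (1 / n) ^ 3 = 1 / n" using n(2) by (simp add: odd_real_root_pow)
  ultimately have "8 / n < S^3 / n^3" by (simp add: power_mult_distrib power_divide)
  then have "8 / n * n^3 < S^3" using n(2) by (simp add: pos_less_divide_eq)
  moreover have "8 / n * n^3 = 8 * n^2" using n(2) by (simp add: power2_eq_square power3_eq_cube)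
  ultimately show ?thesis by simp
qed

text \<open>
  The quadratic form is \<open>\<bar>P + \<omega>Q + \<omega>\<^sup>2R\<bar>\<^sup>2\<close> for a primitive cube root of unity \<open>\<omega>\<close>.
\<close>

lemma near_diagonal:
  fixes P Q R :: real
  assumes S: "P + Q + R > 0"
    and form: "P^2 + Q^2 + R^2 - P*Q - Q*R - P*R \<le> (P + Q + R)^2 / 8"
  shows "P > 0" "P \<le> 7 * Q"
proof -
  define S where "S = P + Q + R"
  \<comment> \<open>The form bounds (3x - S)^2 by S^2/2, and 1/2 <= (3/4)^2. Thus P and Q lie
    between S/12 and 7S/12, whence the ratio 7.\<close>
  have *: "\<bar>3*x - S\<bar> \<le> 3/4 * S"
    if "x = P \<and> y = Q \<and> z = R \<or> x = Q \<and> y = R \<and> z = P" for x y z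
  proof (rule power2_le_imp_le)
    have "(3*x - S)^2 + 3 * (y - z)^2 = 4 * (P^2 + Q^2 + R^2 - P*Q - Q*R - P*R)"
      using that by (auto simp: S_def algebra_simps power2_eq_square)
    then have "(3*x - S)^2 \<le> 4 * (P^2 + Q^2 + R^2 - P*Q - Q*R - P*R)"
      by (metis add.commute le_add_same_cancel2 zero_le_mult_iff zero_le_numeral zero_le_power2)
    also have "\<dots> \<le> 4 * (S^2 / 8)"
      using form by (fold S_def, intro mult_left_mono) simp_all
    also have "\<dots> = S^2 / 2" by simp
    also have "\<dots> \<le> (3/4 * S)^2" by (simp add: power_mult_distrib power_divide)
    finally show "\<bar>3*x - S\<bar>^2 \<le> (3/4 * S)^2" by simp
  qed (use S in \<open>simp add: S_def\<close>)
  from S have "S > 0" by (simp add: S_def)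
  moreover have "\<bar>3*P - S\<bar> \<le> 3/4 * S" "\<bar>3*Q - S\<bar> \<le> 3/4 * S"
    using *[of P Q R] *[of Q R P] by simp_all
  ultimately show "P > 0" "P \<le> 7 * Q" unfolding abs_le_iff by linarith+
qed

text \<open>Taking the adjugate twice multiplies \<alpha> by its norm, so the quadratic form equals
  n\<alpha>. With S = n/\<alpha>, the hypothesis gives n\<alpha>S = n^2 < S^3/8, and dividing by S
  finishes.\<close>

lemma adjugate_comparable:
  fixes x y z n :: real
  defines "P \<equiv> x^2 - 2*y*z" and "Q \<equiv> (2*z^2 - x*y) * \<theta>" and "R \<equiv> (y^2 - x*z) * \<theta>^2"
  assumes n: "x^3 + 2*y^3 + 4*z^3 - 6*x*y*z = n" "n > 0"
    and pos: "0 < x + y * \<theta> + z * \<theta>^2" and bound: "8 * n^2 < (P + Q + R)^3"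
  shows "P + Q + R > 0" "P^2 + Q^2 + R^2 - P*Q - Q*R - P*R \<le> (P + Q + R)^2 / 8"
proof -
  define S where "S = P + Q + R"
  define \<alpha> where "\<alpha> = x + y * \<theta> + z * \<theta>^2"
  have \<alpha>S: "\<alpha> * S = n" unfolding \<alpha>_def S_def P_def Q_def R_def norm_form_eq n(1) ..
  have "S > 0" using \<alpha>S n(2) pos unfolding \<alpha>_def[symmetric] by (metis zero_less_mult_pos)
  then show "P + Q + R > 0" by (simp add: S_def)
  have t3: "\<theta> * (\<theta> * \<theta>) = 2" using theta_cubed by (simp add: power3_eq_cube)
  define A where "A = x^2 - 2*y*z"
  define B where "B = 2*z^2 - x*y"
  define C where "C = y^2 - x*z"
  have "P^2 + Q^2 + R^2 - P*Q - Q*R - P*R =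
      A^2 + B^2 * \<theta>^2 + C^2 * \<theta> * (\<theta> * (\<theta> * \<theta>)) - A*B*\<theta> - B*C*(\<theta> * (\<theta> * \<theta>)) - A*C*\<theta>^2"
    unfolding P_def Q_def R_def A_def[symmetric] B_def[symmetric] C_def[symmetric]
    by (simp add: algebra_simps power2_eq_square)
  also have "\<dots> = (A^2 - 2*B*C) + (2*C^2 - A*B) * \<theta> + (B^2 - A*C) * \<theta>^2"
    unfolding t3 by (simp add: algebra_simps)
  also have "\<dots> = n * \<alpha>"
  proof -
    have "A^2 - 2*B*C = n * x" "2*C^2 - A*B = n * y" "B^2 - A*C = n * z"
      unfolding A_def B_def C_def n(1)[symmetric]
      by (simp_all add: algebra_simps power2_eq_square power3_eq_cube)
    then show ?thesis by (simp add: \<alpha>_def algebra_simps)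
  qed
  also have "\<dots> \<le> S^2 / 8"
  proof -
    have "8 * n * \<alpha> * S = 8 * n^2" unfolding \<alpha>S[symmetric] by (simp add: power2_eq_square)
    also have "\<dots> \<le> S^2 * S" using bound by (simp add: S_def power2_eq_square power3_eq_cube)
    finally show ?thesis using \<open>S > 0\<close> by simp
  qed
  finally show "P^2 + Q^2 + R^2 - P*Q - Q*R - P*R \<le> (P + Q + R)^2 / 8" by (simp add: S_def)
qed

lemma mult_theta_bounds:
  fixes y :: real
  assumes "y * \<theta> > 0"
  shows "y > 0" "y * \<theta> \<le> 2 * y" "y \<le> y * \<theta>"
proof -
  show y: "y > 0" using assms theta_ge_1 by (simp add: zero_less_mult_iff)
  show "y * \<theta> \<le> 2 * y" "y \<le> y * \<theta>"
    using y theta_ge_1 theta_le_2 by (simp_all add: field_simps)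
qed

text \<open>By symmetry \<open>near_diagonal\<close> applies to every ordering of A, Q, R and gives
  ratios at most 7. Removing the powers of \<theta> costs at most \<theta>^2 <= 4, so 28 = 7 * 4
  suffices; the bounds with 2B and 2C also fit.\<close>

lemma ratio_bounds:
  fixes A B C :: real
  defines "Q \<equiv> B * \<theta>" and "R \<equiv> C * \<theta>^2"
  assumes S: "A + Q + R > 0" and form: "A^2 + Q^2 + R^2 - A*Q - Q*R - A*R \<le> (A + Q + R)^2 / 8"
  shows "A > 0" "B > 0" "C > 0" "A \<le> 28 * B" "A \<le> 28 * C" "B \<le> 28 * A" "B \<le> 28 * C"
    "2 * C \<le> 28 * A" "2 * C \<le> 28 * B" "2 * B \<le> 28 * A"
proof -
  have perm: "x > 0 \<and> x \<le> 7 * y" if "x + y + z = A + Q + R"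
    "x^2 + y^2 + z^2 - x*y - y*z - x*z = A^2 + Q^2 + R^2 - A*Q - Q*R - A*R" for x y z
    using near_diagonal[of x y z] that S form by simp
  have c: "A > 0 \<and> A \<le> 7 * Q" "A > 0 \<and> A \<le> 7 * R" "Q > 0 \<and> Q \<le> 7 * A"
    "Q > 0 \<and> Q \<le> 7 * R" "R > 0 \<and> R \<le> 7 * A" "R > 0 \<and> R \<le> 7 * Q"
    by (rule perm[of _ _ R] perm[of _ _ Q] perm[of _ _ A], simp, simp add: algebra_simps)+
  have R: "R = C * \<theta> * \<theta>" by (simp add: R_def power2_eq_square)
  note q = mult_theta_bounds[of B] and r1 = mult_theta_bounds[of "C * \<theta>"]
    and r2 = mult_theta_bounds[of C]
  have q0: "B * \<theta> > 0" using c by (simp add: Q_def)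
  have r0: "C * \<theta> * \<theta> > 0" using c by (simp add: R)
  note q = q[OF q0] and r1 = r1[OF r0] and r2 = r2[OF r1(1)]
  show "A > 0" "B > 0" "C > 0" using c q r2 by auto
  show "A \<le> 28 * B" "A \<le> 28 * C" "B \<le> 28 * A" "2 * C \<le> 28 * A" "2 * B \<le> 28 * A"
    using c q r1 r2 unfolding R Q_def by linarith+
  have "B \<le> 7 * (C * \<theta>)" "C * \<theta> \<le> 7 * B"
    using c theta_ge_1 unfolding R Q_def by simp_all
  then show "B \<le> 28 * C" "2 * C \<le> 28 * B" using q r2 by linarith+
qed

section \<open>Distance on the torus\<close>

lemma torus_dist_le:
  "torus_dist (x, y) (x', y') \<le> \<bar>x - x' - of_int k\<bar> + \<bar>y - y' - of_int l\<bar>"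
proof -
  have "torus_dist (x, y) (x', y') \<le> dist (x, y) ((x', y') + (of_int k, of_int l))"
    unfolding torus_dist_def by (intro cINF_lower bdd_belowI2[of _ 0]) auto
  also have "\<dots> = sqrt ((x - x' - of_int k)^2 + (y - y' - of_int l)^2)"
    by (simp add: dist_Pair_Pair dist_real_def algebra_simps)
  also have "\<dots> \<le> \<bar>x - x' - of_int k\<bar> + \<bar>y - y' - of_int l\<bar>"
    by (rule sqrt_sum_squares_le_sum_abs)
  finally show ?thesis .
qed

text \<open>Here p/d = x/m - (e/d)/m, and x/m differs from x'/m by an integer, so each coordinate
  contributes at most L/m.\<close>

lemma torus_dist_fraction_le:
  fixes p q d e f m x y x' y' :: int and L :: real
  assumes "m > 0" "d > 0" "[x = x'] (mod m)" "[y = y'] (mod m)"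
    and p: "m * p = x * d - e" and q: "m * q = y * d - f"
    and "0 < e" "0 < f" "of_int e \<le> L * of_int d" "of_int f \<le> L * of_int d"
  shows "torus_dist (of_int p / of_int d, of_int q / of_int d)
    (of_int x' / of_int m, of_int y' / of_int m) \<le> 2 * L / of_int m"
proof -
  obtain k l where k: "x - x' = m * k" and l: "y - y' = m * l"
    using assms(3,4) by (auto simp: cong_iff_dvd_diff dvd_def)
  have *: "\<bar>of_int r / of_int d - of_int s' / of_int m - of_int j\<bar> \<le> L / of_int m"
    if "m * r = s * d - g" "s - s' = m * j" "0 < g" "of_int g \<le> L * of_int d" for r s s' g j :: int
  proof -
    have "of_int m * of_int r = (of_int s * of_int d - of_int g :: real)"
      using that(1) by (metis of_int_diff of_int_mult)
    moreover have "of_int s - of_int s' = (of_int m * of_int j :: real)"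
      using that(2) by (metis of_int_diff of_int_mult)
    ultimately have "of_int r / of_int d - of_int s' / of_int m - of_int j =
        - (of_int g / of_int d / of_int m :: real)"
      using assms(1,2) by (simp add: field_simps) algebra
    moreover have "of_int g / of_int d / of_int m \<le> L / of_int m"
      using that(4) assms(1,2) by (intro divide_right_mono) (simp_all add: pos_divide_le_eq)
    ultimately show ?thesis
      using assms(1,2) that(3) by (simp add: abs_mult)
  qed
  show ?thesis
    using torus_dist_le[of "of_int p / of_int d" "of_int q / of_int d" "of_int x' / of_int m"
        "of_int y' / of_int m" k l]
      *[OF p k assms(7,9)] *[OF q l assms(8,10)] by simp
qed

section \<open>Congruences and the three points\<close>

text \<open>Multiplication by \<theta> turns the coordinates (A, B, C) of \<alpha>' into (2C, A, B),
  and modulo m this is scaling by \<nu>. Pairing with (u, v, w) gives \<nu>; multiplying by \<theta>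
  once more gives (2B, 2C, A) and \<nu>^2.\<close>

lemma generator_root_cong:
  fixes m \<nu> a b c u v w :: int
  defines "A \<equiv> a^2 - 2*b*c" and "B \<equiv> 2*c^2 - a*b" and "C \<equiv> b^2 - a*c"
  assumes gen: "PIdl\<^bsub>OK\<^esub> (of_int a + of_int b * \<theta> + of_int c * \<theta>^2) = root_ideal m \<nu>"
    and uvw: "u * A + v * B + w * C = 1"
  shows "[2*C*u + A * v + B*w = \<nu>] (mod m)" "[2*B*u + 2*C * v + A*w = \<nu>^2] (mod m)"
proof -
  note d = generator_dvd[OF gen]
  have "2*C - \<nu>*A = b * (2*b + 2*c*\<nu> + a*\<nu>^2) - a * (2*c + a*\<nu> + b*\<nu>^2)"
    "A - \<nu>*B = a * (a + b*\<nu> + c*\<nu>^2) - c * (2*b + 2*c*\<nu> + a*\<nu>^2)"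
    "B - \<nu>*C = c * (2*c + a*\<nu> + b*\<nu>^2) - b * (a + b*\<nu> + c*\<nu>^2)"
    unfolding A_def B_def C_def
    by (simp_all add: algebra_simps power2_eq_square power3_eq_cube)
  then have 1: "m dvd 2*C - \<nu>*A" "m dvd A - \<nu>*B" "m dvd B - \<nu>*C"
    using d by (simp_all add: dvd_diff dvd_mult)
  have "2*C*u + A * v + B*w - \<nu> * (u * A + v * B + w * C) =
      u * (2*C - \<nu>*A) + v * (A - \<nu>*B) + w * (B - \<nu>*C)"
    by (simp add: algebra_simps)
  moreover have "m dvd \<dots>" using 1 by (intro dvd_add dvd_mult)
  ultimately show "[2*C*u + A * v + B*w = \<nu>] (mod m)" by (simp add: cong_iff_dvd_diff uvw)
  have "2*B*u + 2*C * v + A*w - \<nu>^2 * (u * A + v * B + w * C) =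
      (2*u + \<nu>*w) * (B - \<nu>*C) + (\<nu>*u + v) * (2*C - \<nu>*A) + (\<nu> * v + w) * (A - \<nu>*B)"
    by (simp add: algebra_simps power2_eq_square)
  moreover have "m dvd \<dots>" using 1 by (intro dvd_add dvd_mult)
  ultimately show "[2*B*u + 2*C * v + A*w = \<nu>^2] (mod m)" by (simp add: cong_iff_dvd_diff uvw)
qed

lemma points_close:
  fixes m \<nu> a b c u v w :: int
  defines "A \<equiv> a^2 - 2*b*c" and "B \<equiv> 2*c^2 - a*b" and "C \<equiv> b^2 - a*c"
  assumes m: "m > 0"
    and gen: "PIdl\<^bsub>OK\<^esub> (of_int a + of_int b * \<theta> + of_int c * \<theta>^2) = root_ideal m \<nu>"
    and D: "of_int a + of_int b * \<theta> + of_int c * \<theta>^2 \<in> D"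
    and uvw: "u * A + v * B + w * C = 1"
  shows "torus_dist (of_int (b * u - c * v) / of_int C, of_int (b * v - a * u) / of_int C)
      (of_int \<nu> / of_int m, of_int (\<nu>^2) / of_int m) \<le> 56 / of_int m"
    and "torus_dist (of_int (c * w - a * u) / of_int B, of_int (2 * c * u - b * w) / of_int B)
      (of_int \<nu> / of_int m, of_int (\<nu>^2) / of_int m) \<le> 56 / of_int m"
    and "torus_dist (of_int (a * v - b * w) / of_int A, of_int (a * w - 2 * c * v) / of_int A)
      (of_int \<nu> / of_int m, of_int (\<nu>^2) / of_int m) \<le> 56 / of_int m"
proof -
  define x where "x = 2*C*u + A * v + B*w"
  define y where "y = 2*B*u + 2*C * v + A*w"
  have "inverse (of_int a + of_int b * \<theta> + of_int c * \<theta>^2) > 0"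
    using D by (rule D_imp_inverse_pos)
  then have pos: "of_int a + of_int b * \<theta> + of_int c * \<theta>^2 > 0" by simp
  have nm: "a^3 + 2*b^3 + 4*c^3 - 6*a*b*c = m" by (rule generator_norm[OF m gen pos uvw[unfolded A_def B_def C_def]])
  have nr: "(of_int a)^3 + 2*(of_int b)^3 + 4*(of_int c)^3 - 6 * of_int a * of_int b * of_int c = (of_int m :: real)"
    unfolding nm[symmetric] by simp
  have m': "(of_int m :: real) > 0" using m by simp
  note S = D_adjugate_bound[OF Rats_of_int Rats_of_int Rats_of_int nr m' D]
  note comp = adjugate_comparable[OF nr m' pos S]
  have ABC: "(of_int a)^2 - 2 * of_int b * of_int c = (of_int A :: real)"
    "2*(of_int c)^2 - of_int a * of_int b = (of_int B :: real)"
    "(of_int b)^2 - of_int a * of_int c = (of_int C :: real)"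
    by (simp_all add: A_def B_def C_def)
  note rat = ratio_bounds[OF comp[unfolded ABC]]
  have cong: "[x = \<nu>] (mod m)" "[y = \<nu>^2] (mod m)"
    using generator_root_cong[OF gen uvw[unfolded A_def B_def C_def]] by (simp_all add: x_def y_def A_def B_def C_def)
  have int: "A > 0" "B > 0" "C > 0" using rat(1-3) by simp_all
  \<comment> \<open>Cramer's rule with 1 written as uA + vB + wC and m as the norm form, which makes
    these polynomial identities in a, b, c, u, v, w.\<close>
  have "m * (b * u - c * v) = x * C - B * (u * A + v * B + w * C)"
    "m * (b * v - a * u) = y * C - A * (u * A + v * B + w * C)"
    "m * (c * w - a * u) = x * B - A * (u * A + v * B + w * C)"
    "m * (2 * c * u - b * w) = y * B - 2 * C * (u * A + v * B + w * C)"
    "m * (a * v - b * w) = x * A - 2 * C * (u * A + v * B + w * C)"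
    "m * (a * w - 2 * c * v) = y * A - 2 * B * (u * A + v * B + w * C)"
    unfolding nm[symmetric] x_def y_def A_def B_def C_def
    by (simp_all add: algebra_simps power2_eq_square power3_eq_cube)
  note eqs = this[unfolded uvw mult_1_right]
  show "torus_dist (of_int (b * u - c * v) / of_int C, of_int (b * v - a * u) / of_int C)
      (of_int \<nu> / of_int m, of_int (\<nu>^2) / of_int m) \<le> 56 / of_int m"
    \<comment> \<open>Two coordinates, each with error at most 28/m, give 56.\<close>
    using torus_dist_fraction_le[OF m int(3) cong eqs(1,2), of 28] int rat by simp
  show "torus_dist (of_int (c * w - a * u) / of_int B, of_int (2 * c * u - b * w) / of_int B)
      (of_int \<nu> / of_int m, of_int (\<nu>^2) / of_int m) \<le> 56 / of_int m"
    using torus_dist_fraction_le[OF m int(2) cong eqs(3,4), of 28] int rat by simp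
  show "torus_dist (of_int (a * v - b * w) / of_int A, of_int (a * w - 2 * c * v) / of_int A)
      (of_int \<nu> / of_int m, of_int (\<nu>^2) / of_int m) \<le> 56 / of_int m"
    using torus_dist_fraction_le[OF m int(1) cong eqs(5,6), of 28] int rat by simp
qed

(* In the second and third points the numerators involve (u, w) and (v, w) respectively. The source
   prints (v, u) resp. (u, v) in these places; with those letters the claim is false: the points
   are then not independent of the choice of u, v, w up to O(1/m). *)
theorem theorem1:
  shows "\<exists>C::real. C > 0 \<and>
    (\<forall>(m::int) (\<nu>::int) (a::int) (b::int) (c::int) (u::int) (v::int) (w::int).
       m > 0 \<longrightarrow>
       [\<nu>^3 = 2] (mod m) \<longrightarrow>
       PIdl\<^bsub>OK\<^esub> (of_int a + of_int b * \<theta> + of_int c * \<theta>^2) = root_ideal m \<nu> \<longrightarrow>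
       of_int a + of_int b * \<theta> + of_int c * \<theta>^2 \<in> D \<longrightarrow>
       u * (a^2 - 2*b*c) + v * (2*c^2 - a*b) + w * (b^2 - a*c) = 1 \<longrightarrow>
       (\<forall>p \<in> {(of_int (b * u - c * v) / of_int (b^2 - a*c), of_int (b * v - a * u) / of_int (b^2 - a*c)),
              (of_int (c * w - a * u) / of_int (2*c^2 - a*b), of_int (2 * c * u - b * w) / of_int (2*c^2 - a*b)),
              (of_int (a * v - b * w) / of_int (a^2 - 2*b*c), of_int (a * w - 2 * c * v) / of_int (a^2 - 2*b*c))}.
          torus_dist p (of_int \<nu> / of_int m, of_int (\<nu>^2) / of_int m) \<le> C / of_int m))"
  using points_close by (intro exI[of _ 56]) auto

end
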